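(* Let $G_1\subseteq G_2\subseteq\cdots$ be a strict direct sequence of topological groups and let $G:=\bigcup_{n\in\mathbb N}G_n$ be its direct limit topological group. Then the following holds. (a) If product sets are large in $G$, then each inclusion map $G_n\to G$ is a topological embedding. (b) If product sets are large in $G$ and each $G_n$ is complete, then also $G$ is complete.
   Context: Topological groups are not assumed Hausdorff. $\mathbb N=\{1,2,\ldots\}$. A net $(x_\alpha)_{\alpha\in A}$ in a topological group $G$ is a left Cauchy net if for each identity neighbourhood $U\subseteq G$ there is $\gamma\in A$ with $x_\beta^{-1}x_\alpha\in U$ for all $\alpha,\beta\ge\gamma$. $G$ is complete if every left Cauchy net in $G$ converges. A direct sequence of topological groups is an ascending sequence $G_1\subseteq G_2\subseteq\cdots$ of topological groups such that each inclusion map $G_n\to G_{n+1}$ is a continuous group homomorphism; it is called strict if each inclusion map $G_n\to G_{n+1}$ is a topological embedding (a homeomorphism onto its image). Give $G:=\bigcup_{n}G_n$ the unique group structure making each inclusion $G_n\to G$ a homomorphism. The direct limit topological group is $G$ endowed with the finest group topology $\mathcal O_{TG}$ (topology making $G$ a topological group) for which all inclusion maps $G_n\to G$ are continuous. Product sets are said to be large in $G$ if $\bigcup_{n\in\mathbb N}V_1V_2\cdots V_n$ is an identity neighbourhood in $G$ for every choice of identity neighbourhoods $V_n\subseteq G_n$ ($n\in\mathbb N$). *)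

theory Defs
  imports "HOL-Analysis.Analysis" "HOL-Algebra.Coset"
begin

section \<open>Topological groups\<close>

locale topological_group = group G
  for G :: "('a, 'b) monoid_scheme" (structure) and T :: "'a topology" +
  assumes topspace_eq: "topspace T = carrier G"
    and continuous_mult:
      "continuous_map (prod_topology T T) T (\<lambda>(x, y). x \<otimes> y)"
    and continuous_inv: "continuous_map T T (\<lambda>x. inv x)"

text \<open>Neighbourhoods need not be open.\<close>

definition identity_neighbourhood ::
    "('a, 'b) monoid_scheme \<Rightarrow> 'a topology \<Rightarrow> 'a set \<Rightarrow> bool" where
  "identity_neighbourhood G T U \<longleftrightarrow>
     U \<subseteq> carrier G \<and> (\<exists>W. openin T W \<and> \<one>\<^bsub>G\<^esub> \<in> W \<and> W \<subseteq> U)"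


section \<open>Nets and completeness\<close>

definition directed_set :: "'i set \<Rightarrow> ('i \<Rightarrow> 'i \<Rightarrow> bool) \<Rightarrow> bool" where
  "directed_set A leq \<longleftrightarrow>
     A \<noteq> {} \<and>
     (\<forall>a\<in>A. leq a a) \<and>
     (\<forall>a\<in>A. \<forall>b\<in>A. \<forall>c\<in>A. leq a b \<longrightarrow> leq b c \<longrightarrow> leq a c) \<and>
     (\<forall>a\<in>A. \<forall>b\<in>A. \<exists>c\<in>A. leq a c \<and> leq b c)"

definition net_converges ::
    "'a topology \<Rightarrow> 'i set \<Rightarrow> ('i \<Rightarrow> 'i \<Rightarrow> bool) \<Rightarrow> ('i \<Rightarrow> 'a) \<Rightarrow> 'a \<Rightarrow> bool" where
  "net_converges T A leq x g \<longleftrightarrow>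
     g \<in> topspace T \<and>
     (\<forall>U. openin T U \<longrightarrow> g \<in> U \<longrightarrow> (\<exists>c\<in>A. \<forall>a\<in>A. leq c a \<longrightarrow> x a \<in> U))"

definition left_Cauchy_net ::
    "('a, 'b) monoid_scheme \<Rightarrow> 'a topology \<Rightarrow> 'i set \<Rightarrow> ('i \<Rightarrow> 'i \<Rightarrow> bool) \<Rightarrow>
     ('i \<Rightarrow> 'a) \<Rightarrow> bool" where
  "left_Cauchy_net G T A leq x \<longleftrightarrow>
     directed_set A leq \<and> x \<in> A \<rightarrow> carrier G \<and>
     (\<forall>U. identity_neighbourhood G T U \<longrightarrow>
        (\<exists>c\<in>A. \<forall>a\<in>A. \<forall>b\<in>A. leq c a \<longrightarrow> leq c b \<longrightarrow> inv\<^bsub>G\<^esub> (x b) \<otimes>\<^bsub>G\<^esub> x a \<in> U))"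

text \<open>
  A definition cannot quantify over all index types, so the index sets are taken in
  the single type \<open>'a set \<times> 'a\<close>.  This loses nothing: by
  \<open>complete_group_net_converges\<close> below, left Cauchy nets over directed sets in
  any type then converge.
\<close>

definition complete_group ::
    "('a, 'b) monoid_scheme \<Rightarrow> 'a topology \<Rightarrow> bool" where
  "complete_group G T \<longleftrightarrow>
     (\<forall>(A :: ('a set \<times> 'a) set) leq x.
        left_Cauchy_net G T A leq x \<longrightarrow> (\<exists>g. net_converges T A leq x g))"

lemma complete_group_net_converges:
  fixes A :: "'i set" and G :: "('a, 'b) monoid_scheme"
  assumes complete: "complete_group G T" and cauchy: "left_Cauchy_net G T A leq x"
  shows "\<exists>g. net_converges T A leq x g"
proof -
  define tail where "tail c = x ` {a \<in> A. leq c a}" for c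
  define B where "B = {(S, p). p \<in> S \<and> (\<exists>c\<in>A. S = tail c)}"
  define ge where "ge = (\<lambda>(S, p :: 'a) (S', p' :: 'a). S' \<subseteq> (S :: 'a set))"
  have dir: "directed_set A leq" and xA: "x \<in> A \<rightarrow> carrier G"
    using cauchy by (auto simp: left_Cauchy_net_def)
  have in_tail: "x c \<in> tail c" if "c \<in> A" for c
    using dir that by (auto simp: directed_set_def tail_def)
  have tail_mono: "tail d \<subseteq> tail c" if "c \<in> A" "d \<in> A" "leq c d" for c d
    using dir that unfolding directed_set_def tail_def by blast
  have inB: "(tail c, x c) \<in> B" if "c \<in> A" for c
    using in_tail that by (auto simp: B_def)
  have "\<exists>r\<in>B. ge p r \<and> ge q r" if pq: "p \<in> B" "q \<in> B" for p q
  proof -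
    obtain c d where cd: "c \<in> A" "fst p = tail c" "d \<in> A" "fst q = tail d"
      using pq by (auto simp: B_def)
    obtain e where e: "e \<in> A" "leq c e" "leq d e"
      using dir cd unfolding directed_set_def by blast
    have "ge p (tail e, x e)" "ge q (tail e, x e)"
      using tail_mono cd e by (auto simp: ge_def split_beta)
    then show ?thesis using inB e by blast
  qed
  moreover have "B \<noteq> {}"
    using dir inB by (auto simp: directed_set_def)
  ultimately have dirB: "directed_set B ge"
    by (auto simp: directed_set_def ge_def split_beta)
  have "left_Cauchy_net G T B ge snd"
    unfolding left_Cauchy_net_def
  proof (intro conjI allI impI)
    show "snd \<in> B \<rightarrow> carrier G" using xA by (auto simp: B_def tail_def)
    fix U assume "identity_neighbourhood G T U"
    then obtain c where c: "c \<in> A"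
      "\<And>a b. a \<in> A \<Longrightarrow> b \<in> A \<Longrightarrow> leq c a \<Longrightarrow> leq c b \<Longrightarrow> inv\<^bsub>G\<^esub> (x b) \<otimes>\<^bsub>G\<^esub> x a \<in> U"
      using cauchy unfolding left_Cauchy_net_def by blast
    have "inv\<^bsub>G\<^esub> q \<otimes>\<^bsub>G\<^esub> p \<in> U" if "p \<in> tail c" "q \<in> tail c" for p q
      using that c by (auto simp: tail_def)
    then have "\<forall>p\<in>B. \<forall>q\<in>B. ge (tail c, x c) p \<longrightarrow> ge (tail c, x c) q \<longrightarrow>
        inv\<^bsub>G\<^esub> (snd q) \<otimes>\<^bsub>G\<^esub> snd p \<in> U"
      by (fastforce simp: B_def ge_def)
    then show "\<exists>r\<in>B. \<forall>p\<in>B. \<forall>q\<in>B. ge r p \<longrightarrow> ge r q \<longrightarrow>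
        inv\<^bsub>G\<^esub> (snd q) \<otimes>\<^bsub>G\<^esub> snd p \<in> U"
      using inB c(1) by blast
  qed (fact dirB)
  then obtain g where g: "net_converges T B ge snd g"
    using complete unfolding complete_group_def by blast
  have "\<exists>c\<in>A. \<forall>a\<in>A. leq c a \<longrightarrow> x a \<in> U" if U: "openin T U" "g \<in> U" for U
  proof -
    obtain r where r: "r \<in> B" "\<And>q. q \<in> B \<Longrightarrow> ge r q \<Longrightarrow> snd q \<in> U"
      using g U unfolding net_converges_def by blast
    obtain c where c: "c \<in> A" "fst r = tail c" using r(1) by (auto simp: B_def)
    have "p \<in> U" if "p \<in> tail c" for p
    proof -
      have "(tail c, p) \<in> B" using that c(1) by (auto simp: B_def)
      moreover have "ge r (tail c, p)" using c(2) by (auto simp: ge_def split_beta)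
      ultimately show ?thesis using r(2) by fastforce
    qed
    then show ?thesis using c(1) by (auto simp: tail_def)
  qed
  then show ?thesis using g unfolding net_converges_def by blast
qed


section \<open>Direct sequences and their direct limits\<close>

text \<open>Sequences are indexed from \<open>0\<close>, so \<open>Gs 0\<close> is the first group.\<close>

definition direct_sequence ::
    "(nat \<Rightarrow> ('a, 'b) monoid_scheme) \<Rightarrow> (nat \<Rightarrow> 'a topology) \<Rightarrow> bool" where
  "direct_sequence Gs Ts \<longleftrightarrow>
     (\<forall>n. topological_group (Gs n) (Ts n)) \<and>
     (\<forall>n. carrier (Gs n) \<subseteq> carrier (Gs (Suc n))) \<and>
     (\<forall>n. (\<lambda>x. x) \<in> hom (Gs n) (Gs (Suc n))) \<and>
     (\<forall>n. continuous_map (Ts n) (Ts (Suc n)) (\<lambda>x. x))"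

definition strict_direct_sequence ::
    "(nat \<Rightarrow> ('a, 'b) monoid_scheme) \<Rightarrow> (nat \<Rightarrow> 'a topology) \<Rightarrow> bool" where
  "strict_direct_sequence Gs Ts \<longleftrightarrow>
     direct_sequence Gs Ts \<and> (\<forall>n. embedding_map (Ts n) (Ts (Suc n)) (\<lambda>x. x))"

definition union_group ::
    "(nat \<Rightarrow> ('a, 'b) monoid_scheme) \<Rightarrow> ('a, 'c) monoid_scheme \<Rightarrow> bool" where
  "union_group Gs G \<longleftrightarrow>
     group G \<and> carrier G = (\<Union>n. carrier (Gs n)) \<and> (\<forall>n. (\<lambda>x. x) \<in> hom (Gs n) G)"

definition compatible_group_topology ::
    "(nat \<Rightarrow> 'a topology) \<Rightarrow> ('a, 'c) monoid_scheme \<Rightarrow> 'a topology \<Rightarrow> bool" where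
  "compatible_group_topology Ts G T \<longleftrightarrow>
     topological_group G T \<and> (\<forall>n. continuous_map (Ts n) T (\<lambda>x. x))"

definition direct_limit_topological_group ::
    "(nat \<Rightarrow> ('a, 'b) monoid_scheme) \<Rightarrow> (nat \<Rightarrow> 'a topology) \<Rightarrow>
     ('a, 'c) monoid_scheme \<Rightarrow> 'a topology \<Rightarrow> bool" where
  "direct_limit_topological_group Gs Ts G T \<longleftrightarrow>
     union_group Gs G \<and>
     compatible_group_topology Ts G T \<and>
     (\<forall>T'. compatible_group_topology Ts G T' \<longrightarrow> (\<forall>U. openin T' U \<longrightarrow> openin T U))"

text \<open>
  The direct limit is specified by its defining properties.  The following lemmas show
  that it exists and that its group operation and its topology are uniquely determined.
\<close>

lemma direct_sequence_carrier_mono: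
  assumes "direct_sequence Gs Ts" "m \<le> n"
  shows "carrier (Gs m) \<subseteq> carrier (Gs n)"
  using assms(2) by (rule lift_Suc_mono_le[rotated])
    (use assms(1) in \<open>auto simp: direct_sequence_def\<close>)

lemma direct_sequence_mult:
  assumes ds: "direct_sequence Gs Ts" and "m \<le> n" "x \<in> carrier (Gs m)" "y \<in> carrier (Gs m)"
  shows "x \<otimes>\<^bsub>Gs n\<^esub> y = x \<otimes>\<^bsub>Gs m\<^esub> y"
  using assms(2)
proof (induction n rule: dec_induct)
  case (step n)
  have "x \<in> carrier (Gs n)" "y \<in> carrier (Gs n)"
    using direct_sequence_carrier_mono[OF ds, of m n] step assms by auto
  moreover have "(\<lambda>x. x) \<in> hom (Gs n) (Gs (Suc n))"
    using ds by (auto simp: direct_sequence_def)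
  ultimately show ?case using step by (auto simp: hom_def)
qed simp

lemma union_group_exists:
  fixes Gs :: "nat \<Rightarrow> ('a, 'b) monoid_scheme"
  assumes ds: "direct_sequence Gs Ts"
  shows "\<exists>G :: 'a monoid. union_group Gs G"
proof -
  let ?C = "\<lambda>n. carrier (Gs n)"
  define f where
    "f x y = x \<otimes>\<^bsub>Gs (LEAST n. x \<in> ?C n \<and> y \<in> ?C n)\<^esub> y" for x y
  define G :: "'a monoid" where "G = \<lparr>carrier = (\<Union>n. ?C n), mult = f, one = \<one>\<^bsub>Gs 0\<^esub>\<rparr>"
  have grp: "group (Gs n)" for n
    using ds by (auto simp: direct_sequence_def topological_group_def)
  have f: "f x y = x \<otimes>\<^bsub>Gs n\<^esub> y" if "x \<in> ?C n" "y \<in> ?C n" for x y n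
  proof -
    let ?P = "\<lambda>n. x \<in> ?C n \<and> y \<in> ?C n"
    have "?P (Least ?P)" "Least ?P \<le> n"
      using that LeastI[of ?P n] Least_le[of ?P n] by auto
    then show ?thesis
      using direct_sequence_mult[OF ds, of "Least ?P" n x y] by (simp add: f_def)
  qed
  have mono: "x \<in> ?C n" if "x \<in> ?C m" "m \<le> n" for x m n
    using direct_sequence_carrier_mono[OF ds] that by blast
  have one_in: "\<one>\<^bsub>Gs 0\<^esub> \<in> ?C n" for n
    using mono[of "\<one>\<^bsub>Gs 0\<^esub>" 0 n] grp[of 0] by (simp add: group.is_monoid)
  have one: "\<one>\<^bsub>Gs 0\<^esub> = \<one>\<^bsub>Gs n\<^esub>" for n
  proof -
    have "\<one>\<^bsub>Gs 0\<^esub> \<otimes>\<^bsub>Gs n\<^esub> \<one>\<^bsub>Gs 0\<^esub> = \<one>\<^bsub>Gs 0\<^esub>"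
      using direct_sequence_mult[OF ds, of 0 n] grp[of 0] by (simp add: group.is_monoid)
    then show ?thesis
      using group.l_cancel_one[OF grp one_in one_in] by blast
  qed
  have "group G"
  proof (rule groupI)
    fix x y z assume "x \<in> carrier G" "y \<in> carrier G" "z \<in> carrier G"
    then obtain i j k where "x \<in> ?C i" "y \<in> ?C j" "z \<in> ?C k" by (auto simp: G_def)
    then obtain n where n: "x \<in> ?C n" "y \<in> ?C n" "z \<in> ?C n"
      using mono[of _ _ "max i (max j k)"] by (meson max.cobounded1 max.cobounded2 max.coboundedI2)
    interpret group "Gs n" by (rule grp)
    show "x \<otimes>\<^bsub>G\<^esub> y \<otimes>\<^bsub>G\<^esub> z = x \<otimes>\<^bsub>G\<^esub> (y \<otimes>\<^bsub>G\<^esub> z)"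
      using n by (simp add: G_def f[of _ n] m_assoc)
  next
    fix x y assume "x \<in> carrier G" "y \<in> carrier G"
    then obtain i j where "x \<in> ?C i" "y \<in> ?C j" by (auto simp: G_def)
    then obtain n where n: "x \<in> ?C n" "y \<in> ?C n"
      using mono[of _ _ "max i j"] by (meson max.cobounded1 max.cobounded2)
    interpret group "Gs n" by (rule grp)
    show "x \<otimes>\<^bsub>G\<^esub> y \<in> carrier G"
      using n m_closed[OF n] by (auto simp: G_def f[of _ n])
  next
    show "\<one>\<^bsub>G\<^esub> \<in> carrier G" using one_in by (auto simp: G_def)
  next
    fix x assume "x \<in> carrier G"
    then obtain n where n: "x \<in> ?C n" by (auto simp: G_def)
    interpret group "Gs n" by (rule grp)
    show "\<one>\<^bsub>G\<^esub> \<otimes>\<^bsub>G\<^esub> x = x"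
      using n by (simp add: G_def f[of _ n] one[of n])
    have "inv\<^bsub>Gs n\<^esub> x \<otimes>\<^bsub>G\<^esub> x = \<one>\<^bsub>G\<^esub>"
      using n by (simp add: G_def f[of _ n] one[of n])
    then show "\<exists>y\<in>carrier G. y \<otimes>\<^bsub>G\<^esub> x = \<one>\<^bsub>G\<^esub>"
      using inv_closed[OF n] by (auto simp: G_def)
  qed
  moreover have "(\<lambda>x. x) \<in> hom (Gs n) G" for n
    using f[of _ n] by (auto simp: hom_def G_def)
  ultimately have "union_group Gs G" by (simp add: union_group_def G_def)
  then show ?thesis by blast
qed

lemma union_group_mult_unique:
  assumes "direct_sequence Gs Ts" "union_group Gs G" "union_group Gs H"
    "x \<in> carrier G" "y \<in> carrier G"
  shows "x \<otimes>\<^bsub>G\<^esub> y = x \<otimes>\<^bsub>H\<^esub> y"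
proof -
  obtain i j where ij: "x \<in> carrier (Gs i)" "y \<in> carrier (Gs j)"
    using assms by (auto simp: union_group_def)
  define n where "n = max i j"
  have n: "x \<in> carrier (Gs n)" "y \<in> carrier (Gs n)"
    using direct_sequence_carrier_mono[OF assms(1), of i n]
      direct_sequence_carrier_mono[OF assms(1), of j n] ij by (auto simp: n_def)
  have "(\<lambda>x. x) \<in> hom (Gs n) G" "(\<lambda>x. x) \<in> hom (Gs n) H"
    using assms by (auto simp: union_group_def)
  then have "x \<otimes>\<^bsub>Gs n\<^esub> y = x \<otimes>\<^bsub>G\<^esub> y" "x \<otimes>\<^bsub>Gs n\<^esub> y = x \<otimes>\<^bsub>H\<^esub> y"
    using n by (auto simp: hom_def)
  then show ?thesis by simp
qed

lemma direct_limit_topology_unique: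
  assumes "direct_limit_topological_group Gs Ts G T" "direct_limit_topological_group Gs Ts G T'"
  shows "T = T'"
  using assms unfolding direct_limit_topological_group_def topology_eq by blast

lemma direct_limit_topology_exists:
  fixes G :: "('a, 'c) monoid_scheme"
  assumes ds: "direct_sequence Gs Ts" and G: "union_group Gs G"
  shows "\<exists>T. direct_limit_topological_group Gs Ts G T"
proof -
  let ?F = "{T. compatible_group_topology Ts G T}"
  define S where "S = insert (carrier G) (\<Union>T\<in>?F. Collect (openin T))"
  define T where "T = topology_generated_by S"
  have grp: "group G" using G by (auto simp: union_group_def)
  interpret group G by (rule grp)
  have sub: "U \<subseteq> carrier G" if "U \<in> S" for U
    using that openin_subset
    by (fastforce simp: S_def compatible_group_topology_def topological_group_def
        topological_group_axioms_def)
  then have top: "topspace T = carrier G"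
    by (auto simp: T_def S_def)
  have finer: "openin T U" if "compatible_group_topology Ts G T'" "openin T' U" for T' U
    unfolding T_def by (rule topology_generated_by_Basis) (use that in \<open>auto simp: S_def\<close>)
  have cont: "continuous_map X T h"
    if maps: "h \<in> topspace X \<rightarrow> carrier G"
      and h: "\<And>T'. compatible_group_topology Ts G T' \<Longrightarrow> continuous_map X T' h"
    for X :: "'z topology" and h
    unfolding T_def
  proof (rule continuous_on_generated_topo)
    fix U assume "U \<in> S"
    then consider "U = carrier G" | T' where "compatible_group_topology Ts G T'" "openin T' U"
      by (auto simp: S_def)
    then show "openin X (h -` U \<inter> topspace X)"
    proof cases
      case 1
      then have "h -` U \<inter> topspace X = topspace X" using maps by auto
      then show ?thesis by simp
    next
      case 2
      then have "openin X {x \<in> topspace X. h x \<in> U}"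
        using h openin_continuous_map_preimage by blast
      moreover have "h -` U \<inter> topspace X = {x \<in> topspace X. h x \<in> U}" by auto
      ultimately show ?thesis by simp
    qed
  next
    show "h ` topspace X \<subseteq> \<Union> S" using maps by (auto simp: S_def)
  qed
  have idc: "continuous_map T T' (\<lambda>x. x)" if "compatible_group_topology Ts G T'" for T'
  proof -
    have "topspace T' = carrier G"
      using that by (auto simp: compatible_group_topology_def topological_group_def
        topological_group_axioms_def)
    then have "topspace T = topspace T'" using top by simp
    moreover have "openin T {x \<in> topspace T. x \<in> U}" if U: "openin T' U" for U
    proof -
      have "{x \<in> topspace T. x \<in> U} = U"
        using openin_subset[OF U] calculation by auto
      then show ?thesis using finer[OF \<open>compatible_group_topology Ts G T'\<close> U] by simp
    qed
    ultimately show ?thesis by (auto simp: continuous_map_def)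
  qed
  have "topological_group G T"
  proof
    show "topspace T = carrier G" by (rule top)
    show "continuous_map (prod_topology T T) T (\<lambda>(x, y). x \<otimes>\<^bsub>G\<^esub> y)"
    proof (rule cont)
      fix T' assume T': "compatible_group_topology Ts G T'"
      have "continuous_map (prod_topology T T) (prod_topology T' T') (\<lambda>p. (fst p, snd p))"
        unfolding continuous_map_pairwise o_def
        using continuous_map_compose[OF continuous_map_fst idc[OF T'], unfolded o_def]
          continuous_map_compose[OF continuous_map_snd idc[OF T'], unfolded o_def] by auto
      moreover have "continuous_map (prod_topology T' T') T' (\<lambda>(x, y). x \<otimes>\<^bsub>G\<^esub> y)"
        using T' by (simp add: compatible_group_topology_def topological_group.continuous_mult)
      ultimately show "continuous_map (prod_topology T T) T' (\<lambda>(x, y). x \<otimes>\<^bsub>G\<^esub> y)"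
        using continuous_map_compose by (fastforce simp: o_def)
    qed (auto simp: top)
    show "continuous_map T T (\<lambda>x. inv\<^bsub>G\<^esub> x)"
    proof (rule cont)
      fix T' assume T': "compatible_group_topology Ts G T'"
      then have "continuous_map T' T' (\<lambda>x. inv\<^bsub>G\<^esub> x)"
        by (simp add: compatible_group_topology_def topological_group.continuous_inv)
      from continuous_map_compose[OF idc[OF T'] this]
      show "continuous_map T T' (\<lambda>x. inv\<^bsub>G\<^esub> x)" by (simp add: o_def)
    qed (auto simp: top)
  qed
  moreover have "continuous_map (Ts n) T (\<lambda>x. x)" for n
  proof (rule cont)
    have "topspace (Ts n) = carrier (Gs n)"
      using ds by (auto simp: direct_sequence_def topological_group_def
        topological_group_axioms_def)
    then show "(\<lambda>x. x) \<in> topspace (Ts n) \<rightarrow> carrier G"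
      using G by (auto simp: union_group_def)
  qed (simp add: compatible_group_topology_def)
  ultimately have "direct_limit_topological_group Gs Ts G T"
    using G finer by (auto simp: direct_limit_topological_group_def compatible_group_topology_def)
  then show ?thesis by blast
qed


section \<open>Large product sets\<close>

fun product_set ::
    "('a, 'b) monoid_scheme \<Rightarrow> (nat \<Rightarrow> 'a set) \<Rightarrow> nat \<Rightarrow> 'a set" where
  "product_set G V 0 = V 0"
| "product_set G V (Suc n) = product_set G V n <#>\<^bsub>G\<^esub> V (Suc n)"

definition product_sets_large ::
    "(nat \<Rightarrow> ('a, 'b) monoid_scheme) \<Rightarrow> (nat \<Rightarrow> 'a topology) \<Rightarrow>
     ('a, 'c) monoid_scheme \<Rightarrow> 'a topology \<Rightarrow> bool" where
  "product_sets_large Gs Ts G T \<longleftrightarrow>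
     (\<forall>V. (\<forall>n. identity_neighbourhood (Gs n) (Ts n) (V n)) \<longrightarrow>
        identity_neighbourhood G T (\<Union>n. product_set G V n))"

end

theory Submission
  imports Defs
begin

text \<open>
  For (a), shrink a neighbourhood \<open>P\<^sub>n\<close> of the identity in \<open>G\<^sub>n\<close> along the sequence:
  choose \<open>A\<^sub>k A\<^sub>k \<subseteq> P\<^sub>k\<close> and \<open>P\<^sub>k\<^sub>+\<^sub>1 \<inter> G\<^sub>k \<subseteq> A\<^sub>k\<close>, the latter by strictness. An element of
  \<open>G\<^sub>n\<close> that is a product of factors from the \<open>A\<^sub>k\<close> has its last factor in the previous group,
  hence collapses step by step into \<open>P\<^sub>n\<close>.

  For (b), some \<open>G\<^sub>n\<close> meets \<open>x\<^sub>a U\<close> for cofinally many \<open>a\<close>, for every identity neighbourhood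
  \<open>U\<close>. Otherwise, for each \<open>n\<close> some \<open>U\<^sub>n\<close> witnesses the failure; making these symmetric with
  \<open>U\<^sub>n\<^sub>+\<^sub>1 U\<^sub>n\<^sub>+\<^sub>1 \<subseteq> U\<^sub>n\<close>, the Cauchy property for the product set of the \<open>U\<^sub>k \<inter> G\<^sub>k\<close> writes a
  late \<open>x\<^sub>a\<close> as an element of \<open>G\<^sub>n\<close> times an element of \<open>U\<^sub>n\<close>. The traces of the \<open>x\<^sub>a U\<close> on
  \<open>G\<^sub>n\<close> then form a Cauchy net by (a), and its limit is also the limit of the given net.
\<close>

section \<open>Identity neighbourhoods\<close>

lemma identity_neighbourhood_subset:
  "identity_neighbourhood G T U \<Longrightarrow> U \<subseteq> carrier G"
  by (simp add: identity_neighbourhood_def)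

lemma identity_neighbourhood_one:
  "identity_neighbourhood G T U \<Longrightarrow> \<one>\<^bsub>G\<^esub> \<in> U"
  by (auto simp: identity_neighbourhood_def)

lemma identity_neighbourhood_Int:
  assumes "identity_neighbourhood G T U" "identity_neighbourhood G T V"
  shows "identity_neighbourhood G T (U \<inter> V)"
  using assms unfolding identity_neighbourhood_def
  by (meson IntI Int_mono inf.coboundedI1 openin_Int)

context topological_group
begin

lemma identity_neighbourhood_carrier: "identity_neighbourhood G T (carrier G)"
  using openin_topspace[of T] by (auto simp: identity_neighbourhood_def topspace_eq)

text \<open>Together with the next lemma this moves between open sets around a point
  \<open>g\<close> and neighbourhoods of the identity, so that embeddings and convergence can be
  tested at the identity.\<close>

lemma identity_neighbourhood_translate:
  assumes U: "openin T U" "g \<in> U"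
  shows "identity_neighbourhood G T {u \<in> carrier G. g \<otimes> u \<in> U}"
proof -
  have g: "g \<in> carrier G"
    using openin_subset[OF U(1)] U(2) topspace_eq by auto
  then have "continuous_map T (prod_topology T T) (\<lambda>u. (g, u))"
    by (simp add: continuous_map_pairwise o_def topspace_eq)
  from continuous_map_compose[OF this continuous_mult]
  have "openin T {u \<in> topspace T. g \<otimes> u \<in> U}"
    using U(1) by (auto simp: o_def intro: openin_continuous_map_preimage)
  then show ?thesis
    unfolding identity_neighbourhood_def using U(2) g by (auto simp: topspace_eq)
qed

lemma identity_neighbourhood_inverse_translate:
  assumes U: "identity_neighbourhood G T U" and g: "g \<in> carrier G"
  shows "\<exists>N. openin T N \<and> g \<in> N \<and> (\<forall>y\<in>N. inv g \<otimes> y \<in> U)"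
proof -
  obtain W where W: "openin T W" "\<one> \<in> W" "W \<subseteq> U"
    using U by (auto simp: identity_neighbourhood_def)
  from g have "continuous_map T (prod_topology T T) (\<lambda>u. (inv g, u))"
    by (simp add: continuous_map_pairwise o_def topspace_eq)
  from continuous_map_compose[OF this continuous_mult]
  have "openin T {y \<in> topspace T. inv g \<otimes> y \<in> W}"
    using W(1) by (auto simp: o_def intro: openin_continuous_map_preimage)
  then show ?thesis
    using W g by (intro exI[of _ "{y \<in> topspace T. inv g \<otimes> y \<in> W}"]) (auto simp: topspace_eq)
qed

lemma identity_neighbourhood_inv:
  assumes "identity_neighbourhood G T U"
  shows "identity_neighbourhood G T {u \<in> carrier G. inv u \<in> U}"
proof -
  obtain W where W: "openin T W" "\<one> \<in> W" "W \<subseteq> U"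
    using assms by (auto simp: identity_neighbourhood_def)
  have "openin T {u \<in> topspace T. inv u \<in> W}"
    using continuous_inv W(1) by (rule openin_continuous_map_preimage)
  then show ?thesis
    unfolding identity_neighbourhood_def using W by (auto simp: topspace_eq)
qed

text \<open>Continuity of multiplication at the pair of identities gives a box
  \<open>A \<times> B\<close> that is multiplied into \<open>U\<close>. Intersecting
  \<open>C = A \<inter> B\<close> with its inverse makes it symmetric.\<close>

lemma identity_neighbourhood_square:
  assumes "identity_neighbourhood G T U"
  shows "\<exists>V. identity_neighbourhood G T V \<and> (\<forall>x\<in>V. \<forall>y\<in>V. x \<otimes> y \<in> U) \<and> (\<forall>x\<in>V. inv x \<in> V)"
proof -
  obtain W where W: "openin T W" "\<one> \<in> W" "W \<subseteq> U"
    using assms by (auto simp: identity_neighbourhood_def)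
  define Q where "Q = {p \<in> topspace (prod_topology T T). (\<lambda>(x, y). x \<otimes> y) p \<in> W}"
  have "openin (prod_topology T T) Q"
    unfolding Q_def using continuous_mult W(1) by (rule openin_continuous_map_preimage)
  moreover have "(\<one>, \<one>) \<in> Q"
    using W by (auto simp: Q_def topspace_eq)
  ultimately obtain A B where AB: "openin T A" "openin T B" "\<one> \<in> A" "\<one> \<in> B" "A \<times> B \<subseteq> Q"
    using openin_prod_topology_alt[THEN iffD1, rule_format] by metis
  define C where "C = A \<inter> B"
  have C: "openin T C" "\<one> \<in> C"
    using AB by (auto simp: C_def)
  have C_sub: "C \<subseteq> carrier G"
    using openin_subset[OF C(1)] topspace_eq by simp
  have "identity_neighbourhood G T C"
    unfolding identity_neighbourhood_def using C C_sub by blast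
  then have "identity_neighbourhood G T (C \<inter> {u \<in> carrier G. inv u \<in> C})"
    by (intro identity_neighbourhood_Int identity_neighbourhood_inv)
  moreover have "x \<otimes> y \<in> U" if "x \<in> C" "y \<in> C" for x y
    using that AB(5) W(3) by (fastforce simp: C_def Q_def)
  ultimately show ?thesis
    by (intro exI[of _ "C \<inter> {u \<in> carrier G. inv u \<in> C}"]) auto
qed

end


section \<open>Continuous inclusions of topological groups\<close>

text \<open>A common frame for the steps from \<open>Gs n\<close> to \<open>Gs (Suc n)\<close> and
  for the inclusions of \<open>Gs n\<close> into the limit. Being an embedding is left out: it is
  given for the former and has to be proved for the latter.\<close>

locale continuous_group_inclusion =
  H: topological_group H S + G: topological_group G T
  for H :: "('a, 'b) monoid_scheme" and S :: "'a topology"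
    and G :: "('a, 'c) monoid_scheme" and T :: "'a topology" +
  assumes inclusion_hom: "(\<lambda>x. x) \<in> hom H G"
    and inclusion_continuous: "continuous_map S T (\<lambda>x. x)"
begin

lemma inclusion_group_hom: "group_hom H G (\<lambda>x. x)"
  by unfold_locales (rule inclusion_hom)

lemmas inclusion_closed = group_hom.hom_closed[OF inclusion_group_hom]
  and inclusion_mult = group_hom.hom_mult[OF inclusion_group_hom]
  and inclusion_one = group_hom.hom_one[OF inclusion_group_hom]
  and inclusion_inv = group_hom.hom_inv[OF inclusion_group_hom]

lemma carrier_subset: "carrier H \<subseteq> carrier G"
  using inclusion_closed by blast

lemma identity_neighbourhood_trace:
  assumes "identity_neighbourhood G T U"
  shows "identity_neighbourhood H S (U \<inter> carrier H)"
proof -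
  obtain W where W: "openin T W" "\<one>\<^bsub>G\<^esub> \<in> W" "W \<subseteq> U"
    using assms by (auto simp: identity_neighbourhood_def)
  have "openin S {x \<in> topspace S. x \<in> W}"
    using inclusion_continuous W(1) by (rule openin_continuous_map_preimage)
  moreover have "\<one>\<^bsub>H\<^esub> \<in> W" using W(2) inclusion_one by simp
  ultimately show ?thesis
    unfolding identity_neighbourhood_def using W(3)
    by (intro conjI exI[of _ "{x \<in> topspace S. x \<in> W}"]) (auto simp: H.topspace_eq)
qed

lemma embedding_extend_identity_neighbourhood:
  assumes emb: "embedding_map S T (\<lambda>x. x)" and U: "identity_neighbourhood H S U"
  shows "\<exists>W. identity_neighbourhood G T W \<and> W \<inter> carrier H \<subseteq> U"
proof -
  obtain V where V: "openin S V" "\<one>\<^bsub>H\<^esub> \<in> V" "V \<subseteq> U"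
    using U by (auto simp: identity_neighbourhood_def)
  \<comment> \<open>The inclusion has image \<open>carrier H\<close>, so being an embedding makes it
    open onto that subspace.\<close>
  have "open_map S (subtopology T (carrier H)) (\<lambda>x. x)"
    using emb by (simp add: embedding_map_def homeomorphic_eq_everything_map H.topspace_eq)
  then have "openin (subtopology T (carrier H)) V"
    using V(1) unfolding open_map_def by fastforce
  then obtain W where W: "openin T W" "V = W \<inter> carrier H"
    by (auto simp: openin_subtopology)
  have "identity_neighbourhood G T W"
    unfolding identity_neighbourhood_def
    using W V(2) inclusion_one openin_subset[OF W(1)] G.topspace_eq by auto
  then show ?thesis using W(2) V(3) by blast
qed

text \<open>Converse of the preceding lemma, by homogeneity: an open set around \<open>g\<close> is
  translated to the identity in \<open>H\<close>, extended to \<open>G\<close> there, and translated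
  back to \<open>g\<close> in \<open>G\<close>.\<close>

lemma embedding_mapI:
  assumes ext: "\<And>U. identity_neighbourhood H S U \<Longrightarrow>
    \<exists>W. identity_neighbourhood G T W \<and> W \<inter> carrier H \<subseteq> U"
  shows "embedding_map S T (\<lambda>x. x)"
proof -
  have "openin (subtopology T (carrier H)) V" if V: "openin S V" for V
  proof (subst openin_subopen, intro ballI)
    fix g assume g: "g \<in> V"
    have VH: "V \<subseteq> carrier H"
      using openin_subset[OF V] H.topspace_eq by simp
    then have gH: "g \<in> carrier H" using g by blast
    obtain W where W: "identity_neighbourhood G T W"
      "W \<inter> carrier H \<subseteq> {u \<in> carrier H. g \<otimes>\<^bsub>H\<^esub> u \<in> V}"
      using ext[OF H.identity_neighbourhood_translate[OF V g]] by blast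
    obtain N where N: "openin T N" "g \<in> N" "\<And>y. y \<in> N \<Longrightarrow> inv\<^bsub>G\<^esub> g \<otimes>\<^bsub>G\<^esub> y \<in> W"
      using G.identity_neighbourhood_inverse_translate[OF W(1) inclusion_closed[OF gH]] by blast
    have "N \<inter> carrier H \<subseteq> V"
    proof
      fix y assume y: "y \<in> N \<inter> carrier H"
      have eq: "inv\<^bsub>G\<^esub> g \<otimes>\<^bsub>G\<^esub> y = inv\<^bsub>H\<^esub> g \<otimes>\<^bsub>H\<^esub> y"
        using y inclusion_mult[OF H.inv_closed[OF gH]] inclusion_inv[OF gH] by simp
      have "inv\<^bsub>H\<^esub> g \<otimes>\<^bsub>H\<^esub> y \<in> W \<inter> carrier H"
        using N(3)[of y] y gH eq by auto
      then have "g \<otimes>\<^bsub>H\<^esub> (inv\<^bsub>H\<^esub> g \<otimes>\<^bsub>H\<^esub> y) \<in> V" using W(2) by blast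
      then show "y \<in> V"
        using y gH by (simp add: H.m_assoc[symmetric])
    qed
    then show "\<exists>Q. openin (subtopology T (carrier H)) Q \<and> g \<in> Q \<and> Q \<subseteq> V"
      using N(1,2) gH by (intro exI[of _ "N \<inter> carrier H"]) (auto simp: openin_subtopology)
  qed
  then have "open_map S (subtopology T (carrier H)) (\<lambda>x. x)"
    by (simp add: open_map_def)
  moreover have "continuous_map S (subtopology T (carrier H)) (\<lambda>x. x)"
    using inclusion_continuous by (auto simp: continuous_map_in_subtopology H.topspace_eq)
  moreover have "topspace (subtopology T (carrier H)) = carrier H"
    using carrier_subset by (auto simp: G.topspace_eq)
  ultimately show ?thesis
    unfolding embedding_map_def
    by (intro bijective_open_imp_homeomorphic_map) (simp_all add: H.topspace_eq)
qed

section \<open>Convergence of Cauchy nets that stay close to a complete subgroup\<close>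

text \<open>By \<open>close\<close>, the sets \<open>x a U\<close> meet \<open>H\<close> for
  cofinally many \<open>a\<close>. Points of \<open>H\<close> in such sets form a Cauchy net of
  \<open>H\<close>, since they inherit the Cauchy property of \<open>x\<close>, and its limit
  attracts \<open>x\<close> as well.\<close>

lemma left_Cauchy_net_converges_if_close_to_complete_subgroup:
  assumes emb: "embedding_map S T (\<lambda>x. x)" and complete: "complete_group H S"
    and cauchy: "left_Cauchy_net G T A leq x"
    and close: "\<And>c U. c \<in> A \<Longrightarrow> identity_neighbourhood G T U \<Longrightarrow>
      \<exists>a\<in>A. leq c a \<and> (\<exists>p\<in>carrier H. inv\<^bsub>G\<^esub> (x a) \<otimes>\<^bsub>G\<^esub> p \<in> U)"
  shows "\<exists>g. net_converges T A leq x g"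
proof -
  have dir: "directed_set A leq" and xG: "\<And>a. a \<in> A \<Longrightarrow> x a \<in> carrier G"
    using cauchy by (auto simp: left_Cauchy_net_def)
  have cauchyD: "\<exists>c\<in>A. \<forall>a\<in>A. \<forall>b\<in>A. leq c a \<longrightarrow> leq c b \<longrightarrow> inv\<^bsub>G\<^esub> (x b) \<otimes>\<^bsub>G\<^esub> x a \<in> U"
    if "identity_neighbourhood G T U" for U
    using cauchy that by (auto simp: left_Cauchy_net_def)
  have trans: "leq a c" if "a \<in> A" "b \<in> A" "c \<in> A" "leq a b" "leq b c" for a b c
    using dir that unfolding directed_set_def by blast
  define near where
    "near c U p \<longleftrightarrow> p \<in> carrier H \<and> (\<exists>a\<in>A. leq c a \<and> inv\<^bsub>G\<^esub> (x a) \<otimes>\<^bsub>G\<^esub> p \<in> U)" for c U p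
  \<comment> \<open>The index carries the approximating point \<open>p\<close> itself, so the net in
    \<open>H\<close> is a projection and no points have to be chosen. The preorder \<open>le\<close>
    ignores \<open>p\<close>.\<close>
  define B where "B = {(c, U, p). c \<in> A \<and> identity_neighbourhood G T U \<and> near c U p}"
  define le where "le = (\<lambda>(c, U, p :: 'a) (c', U', p' :: 'a). leq c c' \<and> U' \<subseteq> (U :: 'a set))"
  have B_ne: "\<exists>p. (c, U, p) \<in> B" if "c \<in> A" "identity_neighbourhood G T U" for c U
    using close[OF that] that by (auto simp: B_def near_def)
  have dirB: "directed_set B le"
    unfolding directed_set_def
  proof (intro conjI ballI impI)
    show "B \<noteq> {}"
      using B_ne[OF _ G.identity_neighbourhood_carrier] dir by (auto simp: directed_set_def)
    show "le r r" if "r \<in> B" for r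
      using that dir by (auto simp: B_def le_def directed_set_def)
    show "le r t" if "r \<in> B" "s \<in> B" "t \<in> B" "le r s" "le s t" for r s t
    proof -
      obtain c U p d V q e W w where "r = (c, U, p)" "s = (d, V, q)" "t = (e, W, w)"
        by (metis prod_cases3)
      then show ?thesis using that trans[of c d e] by (auto simp: B_def le_def)
    qed
    show "\<exists>t\<in>B. le r t \<and> le s t" if rs: "r \<in> B" "s \<in> B" for r s
    proof -
      obtain c U p d V q where eq: "r = (c, U, p)" "s = (d, V, q)"
        by (metis prod_cases3)
      have "c \<in> A" "d \<in> A" and UV: "identity_neighbourhood G T (U \<inter> V)"
        using rs eq by (auto simp: B_def intro: identity_neighbourhood_Int)
      then obtain e where e: "e \<in> A" "leq c e" "leq d e"
        using dir unfolding directed_set_def by blast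
      obtain t where "(e, U \<inter> V, t) \<in> B" using B_ne[OF e(1) UV] by blast
      then show ?thesis using e eq by (intro bexI) (auto simp: le_def)
    qed
  qed
  have "left_Cauchy_net H S B le (\<lambda>r. snd (snd r))"
    unfolding left_Cauchy_net_def
  proof (intro conjI allI impI)
    show "(\<lambda>r. snd (snd r)) \<in> B \<rightarrow> carrier H"
      by (auto simp: B_def near_def)
    fix U assume "identity_neighbourhood H S U"
    then obtain W where W: "identity_neighbourhood G T W" "W \<inter> carrier H \<subseteq> U"
      using embedding_extend_identity_neighbourhood[OF emb] by blast
    \<comment> \<open>Two halvings, because \<open>q^-1 p\<close> is the product of the three
      factors \<open>(x_b^-1 q)^-1\<close>, \<open>x_b^-1 x_a\<close> and \<open>x_a^-1 p\<close>,
      all in \<open>W2\<close>: the first two multiply into \<open>W1\<close>, and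
      \<open>W2 \<subseteq> W1\<close> covers the third.\<close>
    obtain W1 where W1: "identity_neighbourhood G T W1"
      "\<And>x y. x \<in> W1 \<Longrightarrow> y \<in> W1 \<Longrightarrow> x \<otimes>\<^bsub>G\<^esub> y \<in> W" "\<And>x. x \<in> W1 \<Longrightarrow> inv\<^bsub>G\<^esub> x \<in> W1"
      using G.identity_neighbourhood_square[OF W(1)] by blast
    obtain W2 where W2: "identity_neighbourhood G T W2"
      "\<And>x y. x \<in> W2 \<Longrightarrow> y \<in> W2 \<Longrightarrow> x \<otimes>\<^bsub>G\<^esub> y \<in> W1" "\<And>x. x \<in> W2 \<Longrightarrow> inv\<^bsub>G\<^esub> x \<in> W2"
      using G.identity_neighbourhood_square[OF W1(1)] by blast
    note subs = identity_neighbourhood_subset[OF W1(1)] identity_neighbourhood_subset[OF W2(1)]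
    have W21: "y \<in> W1" if "y \<in> W2" for y
      using W2(2)[OF that identity_neighbourhood_one[OF W2(1)]] that subs by auto
    obtain c where c: "c \<in> A"
      "\<And>a b. a \<in> A \<Longrightarrow> b \<in> A \<Longrightarrow> leq c a \<Longrightarrow> leq c b \<Longrightarrow> inv\<^bsub>G\<^esub> (x b) \<otimes>\<^bsub>G\<^esub> x a \<in> W2"
      using cauchyD[OF W2(1)] by blast
    obtain p0 where r0: "(c, W2, p0) \<in> B" using B_ne[OF c(1) W2(1)] by blast
    have key: "inv\<^bsub>H\<^esub> q \<otimes>\<^bsub>H\<^esub> p \<in> U" if near: "near c W2 p" "near c W2 q" for p q
    proof -
      obtain a b where ab: "a \<in> A" "leq c a" "inv\<^bsub>G\<^esub> (x a) \<otimes>\<^bsub>G\<^esub> p \<in> W2"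
        "b \<in> A" "leq c b" "inv\<^bsub>G\<^esub> (x b) \<otimes>\<^bsub>G\<^esub> q \<in> W2"
        using near unfolding near_def by blast
      have pq: "p \<in> carrier H" "q \<in> carrier H" using that by (auto simp: near_def)
      have pqG: "p \<in> carrier G" "q \<in> carrier G" using pq carrier_subset by auto
      have "inv\<^bsub>G\<^esub> (inv\<^bsub>G\<^esub> (x b) \<otimes>\<^bsub>G\<^esub> q) \<otimes>\<^bsub>G\<^esub> (inv\<^bsub>G\<^esub> (x b) \<otimes>\<^bsub>G\<^esub> x a) \<in> W1"
        using W2(2,3) ab c(2) by blast
      then have "inv\<^bsub>G\<^esub> (inv\<^bsub>G\<^esub> (x b) \<otimes>\<^bsub>G\<^esub> q) \<otimes>\<^bsub>G\<^esub> (inv\<^bsub>G\<^esub> (x b) \<otimes>\<^bsub>G\<^esub> x a) \<otimes>\<^bsub>G\<^esub>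
          (inv\<^bsub>G\<^esub> (x a) \<otimes>\<^bsub>G\<^esub> p) \<in> W"
        using W1(2) W21 ab(3) by blast
      moreover have "inv\<^bsub>G\<^esub> (inv\<^bsub>G\<^esub> (x b) \<otimes>\<^bsub>G\<^esub> q) \<otimes>\<^bsub>G\<^esub> (inv\<^bsub>G\<^esub> (x b) \<otimes>\<^bsub>G\<^esub> x a) \<otimes>\<^bsub>G\<^esub>
          (inv\<^bsub>G\<^esub> (x a) \<otimes>\<^bsub>G\<^esub> p) = inv\<^bsub>G\<^esub> q \<otimes>\<^bsub>G\<^esub> p"
        using xG[OF ab(1)] xG[OF ab(4)] pqG
        by (simp add: G.inv_mult_group G.m_assoc G.inv_solve_left)
           (simp add: G.m_assoc[symmetric])
      moreover have "inv\<^bsub>G\<^esub> q \<otimes>\<^bsub>G\<^esub> p = inv\<^bsub>H\<^esub> q \<otimes>\<^bsub>H\<^esub> p"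
        using inclusion_mult[OF H.inv_closed[OF pq(2)] pq(1)] inclusion_inv[OF pq(2)] by simp
      moreover have "inv\<^bsub>H\<^esub> q \<otimes>\<^bsub>H\<^esub> p \<in> carrier H" using pq by simp
      ultimately show ?thesis using W(2) by auto
    qed
    \<comment> \<open>Indices beyond \<open>(c, W2, p0)\<close> have a later first component and a
      smaller neighbourhood, so their points satisfy the hypothesis of \<open>key\<close>.\<close>
    have "near c W2 (snd (snd r))" if "r \<in> B" "le (c, W2, p0) r" for r
    proof -
      obtain d V q where r: "r = (d, V, q)" by (metis prod_cases3)
      then have "d \<in> A" "leq c d" "V \<subseteq> W2" "near d V q"
        using that by (auto simp: B_def le_def)
      moreover from this obtain a where
        "q \<in> carrier H" "a \<in> A" "leq d a" "inv\<^bsub>G\<^esub> (x a) \<otimes>\<^bsub>G\<^esub> q \<in> V"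
        by (auto simp: near_def)
      ultimately show ?thesis
        using trans[OF c(1), of d a] r by (auto simp: near_def)
    qed
    then show "\<exists>r\<in>B. \<forall>p\<in>B. \<forall>q\<in>B. le r p \<longrightarrow> le r q \<longrightarrow>
        inv\<^bsub>H\<^esub> (snd (snd q)) \<otimes>\<^bsub>H\<^esub> snd (snd p) \<in> U"
      using r0 key by blast
  qed (fact dirB)
  \<comment> \<open>The index type of \<open>B\<close> differs from the one fixed in
    \<open>complete_group\<close>, hence the passage through
    \<open>complete_group_net_converges\<close>.\<close>
  then obtain g where g: "net_converges S B le (\<lambda>r. snd (snd r)) g"
    using complete_group_net_converges[OF complete] by blast
  then have gH: "g \<in> carrier H" by (simp add: net_converges_def H.topspace_eq)
  then have gG: "g \<in> carrier G" using carrier_subset by blast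
  have "\<exists>c\<in>A. \<forall>a\<in>A. leq c a \<longrightarrow> x a \<in> U" if U: "openin T U" "g \<in> U" for U
  proof -
    \<comment> \<open>The aim is to write
      \<open>x_b = g (g^-1 p) ((x_a^-1 p)^-1 (x_a^-1 x_b))\<close> with both bracketed factors after
      \<open>g\<close> in \<open>W\<close>. The second is itself a product of two elements of
      \<open>W1\<close>.\<close>
    obtain W where W: "identity_neighbourhood G T W"
      "\<And>x y. x \<in> W \<Longrightarrow> y \<in> W \<Longrightarrow> x \<otimes>\<^bsub>G\<^esub> y \<in> {u \<in> carrier G. g \<otimes>\<^bsub>G\<^esub> u \<in> U}"
      using G.identity_neighbourhood_square[OF G.identity_neighbourhood_translate[OF U]] by blast
    obtain W1 where W1: "identity_neighbourhood G T W1"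
      "\<And>x y. x \<in> W1 \<Longrightarrow> y \<in> W1 \<Longrightarrow> x \<otimes>\<^bsub>G\<^esub> y \<in> W" "\<And>x. x \<in> W1 \<Longrightarrow> inv\<^bsub>G\<^esub> x \<in> W1"
      using G.identity_neighbourhood_square[OF W(1)] by blast
    note subs = identity_neighbourhood_subset[OF W1(1)]
    have W1W: "y \<in> W" if "y \<in> W1" for y
      using W1(2)[OF that identity_neighbourhood_one[OF W1(1)]] that subs by auto
    obtain N where N: "openin T N" "g \<in> N" "\<And>y. y \<in> N \<Longrightarrow> inv\<^bsub>G\<^esub> g \<otimes>\<^bsub>G\<^esub> y \<in> W1"
      using G.identity_neighbourhood_inverse_translate[OF W1(1) gG] by blast
    have "openin S {y \<in> topspace S. y \<in> N}"
      using inclusion_continuous N(1) by (rule openin_continuous_map_preimage)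
    then obtain r where r: "r \<in> B" "\<And>s. s \<in> B \<Longrightarrow> le r s \<Longrightarrow> snd (snd s) \<in> N"
      using g gH N(2) unfolding net_converges_def by (fastforce simp: H.topspace_eq)
    obtain c where c: "c \<in> A"
      "\<And>a b. a \<in> A \<Longrightarrow> b \<in> A \<Longrightarrow> leq c a \<Longrightarrow> leq c b \<Longrightarrow> inv\<^bsub>G\<^esub> (x b) \<otimes>\<^bsub>G\<^esub> x a \<in> W1"
      using cauchyD[OF W1(1)] by blast
    obtain p0 where p0: "(c, W1, p0) \<in> B" using B_ne[OF c(1) W1(1)] by blast
    \<comment> \<open>Being beyond \<open>r\<close> puts the point \<open>p\<close> of
      \<open>s\<close> near \<open>g\<close>; being beyond \<open>(c, W1, p0)\<close> provides an
      \<open>a\<close> in the Cauchy tail with \<open>x a\<close> near \<open>p\<close>.\<close>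
    obtain s where s: "s \<in> B" "le r s" "le (c, W1, p0) s"
      using dirB r(1) p0 unfolding directed_set_def by blast
    obtain d V p where s_eq: "s = (d, V, p)" by (metis prod_cases3)
    have d: "d \<in> A" "leq c d" "V \<subseteq> W1" "near d V p"
      using s s_eq by (auto simp: B_def le_def)
    then obtain a where a: "a \<in> A" "leq d a" "inv\<^bsub>G\<^esub> (x a) \<otimes>\<^bsub>G\<^esub> p \<in> W1"
      by (auto simp: near_def)
    have pG: "p \<in> carrier G" using d(4) carrier_subset by (auto simp: near_def)
    have pO: "inv\<^bsub>G\<^esub> g \<otimes>\<^bsub>G\<^esub> p \<in> W1" using N(3) r(2)[OF s(1,2)] s_eq by simp
    have ca: "leq c a" using trans[OF c(1) d(1) a(1) d(2) a(2)] .
    have "x b \<in> U" if b: "b \<in> A" "leq c b" for b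
    proof -
      have "inv\<^bsub>G\<^esub> (inv\<^bsub>G\<^esub> (x a) \<otimes>\<^bsub>G\<^esub> p) \<otimes>\<^bsub>G\<^esub> (inv\<^bsub>G\<^esub> (x a) \<otimes>\<^bsub>G\<^esub> x b) \<in> W"
        using W1(2,3) a c(2) b ca by blast
      then have "g \<otimes>\<^bsub>G\<^esub> ((inv\<^bsub>G\<^esub> g \<otimes>\<^bsub>G\<^esub> p) \<otimes>\<^bsub>G\<^esub>
          (inv\<^bsub>G\<^esub> (inv\<^bsub>G\<^esub> (x a) \<otimes>\<^bsub>G\<^esub> p) \<otimes>\<^bsub>G\<^esub> (inv\<^bsub>G\<^esub> (x a) \<otimes>\<^bsub>G\<^esub> x b))) \<in> U"
        using W(2) W1W[OF pO] by blast
      moreover have "g \<otimes>\<^bsub>G\<^esub> ((inv\<^bsub>G\<^esub> g \<otimes>\<^bsub>G\<^esub> p) \<otimes>\<^bsub>G\<^esub>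
          (inv\<^bsub>G\<^esub> (inv\<^bsub>G\<^esub> (x a) \<otimes>\<^bsub>G\<^esub> p) \<otimes>\<^bsub>G\<^esub> (inv\<^bsub>G\<^esub> (x a) \<otimes>\<^bsub>G\<^esub> x b))) = x b"
        using xG[OF a(1)] xG[OF b(1)] pG gG
        by (simp add: G.inv_mult_group G.m_assoc)
           (simp add: G.m_assoc[symmetric])
      ultimately show ?thesis by simp
    qed
    then show ?thesis using c(1) by blast
  qed
  then show ?thesis
    using gG unfolding net_converges_def by (auto simp: G.topspace_eq)
qed

end


section \<open>Product sets\<close>

lemma product_set_cong:
  "(\<And>k. k \<le> n \<Longrightarrow> V k = W k) \<Longrightarrow> product_set G V n = product_set G W n"
  by (induction n) auto

lemma (in monoid) product_set_closed:
  assumes "\<And>k. V k \<subseteq> carrier G"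
  shows "product_set G V n \<subseteq> carrier G"
  using assms by (induction n) (simp_all add: set_mult_closed)

text \<open>Appending the identity as further factors lengthens a product without changing it. This
  lets a member of the union be read as a product reaching beyond any prescribed stage.\<close>

lemma (in monoid) product_set_mono:
  assumes "\<And>k. V k \<subseteq> carrier G" "\<And>k. \<one> \<in> V k" "m \<le> n"
  shows "product_set G V m \<subseteq> product_set G V n"
  using assms(3)
proof (induction n rule: dec_induct)
  case (step n)
  have "x \<in> product_set G V n <#> V (Suc n)" if x: "x \<in> product_set G V n" for x
  proof -
    have "x \<otimes> \<one> \<in> product_set G V n <#> V (Suc n)"
      using x assms(2) by (auto simp: set_mult_def)
    moreover have "x \<in> carrier G"
      using product_set_closed[of V n, OF assms(1)] x by blast
    ultimately show ?thesis by simp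
  qed
  then show ?case using step by auto
qed simp


section \<open>Strict direct sequences\<close>

locale strict_direct_limit =
  fixes Gs :: "nat \<Rightarrow> ('a, 'b) monoid_scheme" and Ts :: "nat \<Rightarrow> 'a topology"
    and G :: "('a, 'c) monoid_scheme" and T :: "'a topology"
  assumes strict: "strict_direct_sequence Gs Ts"
    and limit: "direct_limit_topological_group Gs Ts G T"
begin

lemma direct: "direct_sequence Gs Ts"
  using strict by (simp add: strict_direct_sequence_def)

sublocale G: topological_group G T
  using limit by (simp add: direct_limit_topological_group_def compatible_group_topology_def)

sublocale incl: continuous_group_inclusion "Gs n" "Ts n" G T for n
proof (intro continuous_group_inclusion.intro continuous_group_inclusion_axioms.intro)
  show "topological_group (Gs n) (Ts n)" using direct by (simp add: direct_sequence_def)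
  show "(\<lambda>x. x) \<in> hom (Gs n) G" "continuous_map (Ts n) T (\<lambda>x. x)"
    using limit by (simp_all add: direct_limit_topological_group_def union_group_def
        compatible_group_topology_def)
qed (rule G.topological_group_axioms)

lemma step_inclusion:
  "continuous_group_inclusion (Gs n) (Ts n) (Gs (Suc n)) (Ts (Suc n))"
  using direct by (simp add: continuous_group_inclusion_def direct_sequence_def
      continuous_group_inclusion_axioms_def)

lemma step_embedding: "embedding_map (Ts n) (Ts (Suc n)) (\<lambda>x. x)"
  using strict by (simp add: strict_direct_sequence_def)

lemma carrier_mono: "m \<le> n \<Longrightarrow> carrier (Gs m) \<subseteq> carrier (Gs n)"
  by (rule direct_sequence_carrier_mono[OF direct])

lemma carrier_limit: "carrier G = (\<Union>n. carrier (Gs n))"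
  using limit by (simp add: direct_limit_topological_group_def union_group_def)

lemma mult_closed:
  assumes "x \<in> carrier (Gs n)" "y \<in> carrier (Gs n)"
  shows "x \<otimes>\<^bsub>G\<^esub> y \<in> carrier (Gs n)"
  using incl.H.m_closed[OF assms] incl.inclusion_mult[OF assms] by simp

text \<open>Serves to push the last factor of a product down into a smaller group of the
  sequence.\<close>

lemma mult_mem_cancel_left:
  assumes "x \<in> carrier (Gs n)" "y \<in> carrier G" "x \<otimes>\<^bsub>G\<^esub> y \<in> carrier (Gs n)"
  shows "y \<in> carrier (Gs n)"
proof -
  have "x \<in> carrier G" using assms(1) incl.carrier_subset by blast
  then have "inv\<^bsub>Gs n\<^esub> x \<otimes>\<^bsub>G\<^esub> (x \<otimes>\<^bsub>G\<^esub> y) = y"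
    using assms by (simp add: incl.inclusion_inv G.m_assoc[symmetric])
  then show ?thesis
    using mult_closed[OF incl.H.inv_closed[OF assms(1)] assms(3)] by simp
qed

lemma product_set_subset_carrier:
  assumes "\<And>k. k \<le> n \<Longrightarrow> V k \<subseteq> carrier (Gs k)"
  shows "product_set G V n \<subseteq> carrier (Gs n)"
  using assms
proof (induction n)
  case (Suc n)
  have "product_set G V n \<subseteq> carrier (Gs n)"
    by (rule Suc.IH) (rule Suc.prems, simp)
  also have "\<dots> \<subseteq> carrier (Gs (Suc n))"
    by (rule carrier_mono) simp
  finally have "product_set G V n \<subseteq> carrier (Gs (Suc n))" .
  moreover have "V (Suc n) \<subseteq> carrier (Gs (Suc n))"
    by (rule Suc.prems) simp
  ultimately show ?case
    unfolding product_set.simps set_mult_def using mult_closed by blast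
qed simp

section \<open>Traces of product sets on a step, and the embedding of each step\<close>

text \<open>Halve \<open>U\<close> to \<open>W\<close>: the last factor is \<open>W\<close>, and the
  earlier factors are chosen by induction inside the trace of \<open>W\<close> on the previous
  group.\<close>

lemma product_set_subset_identity_neighbourhood:
  assumes "identity_neighbourhood (Gs n) (Ts n) U"
  shows "\<exists>V. (\<forall>k\<le>n. identity_neighbourhood (Gs k) (Ts k) (V k)) \<and> product_set G V n \<subseteq> U"
  using assms
proof (induction n arbitrary: U)
  case 0
  then show ?case by (intro exI[of _ "\<lambda>_. U"]) simp
next
  case (Suc n)
  interpret step: continuous_group_inclusion "Gs n" "Ts n" "Gs (Suc n)" "Ts (Suc n)"
    by (rule step_inclusion)
  obtain W where W: "identity_neighbourhood (Gs (Suc n)) (Ts (Suc n)) W"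
    "\<And>x y. x \<in> W \<Longrightarrow> y \<in> W \<Longrightarrow> x \<otimes>\<^bsub>Gs (Suc n)\<^esub> y \<in> U"
      using incl.H.identity_neighbourhood_square[OF Suc.prems] by blast
  obtain V where V: "\<And>k. k \<le> n \<Longrightarrow> identity_neighbourhood (Gs k) (Ts k) (V k)"
    "product_set G V n \<subseteq> W \<inter> carrier (Gs n)"
    using Suc.IH[OF step.identity_neighbourhood_trace[OF W(1)]] by blast
  define V' where "V' = V(Suc n := W)"
  have "product_set G V' n \<subseteq> W"
    using V(2) product_set_cong[of n V' V G] by (auto simp: V'_def)
  moreover have "x \<otimes>\<^bsub>G\<^esub> y \<in> U" if xy: "x \<in> W" "y \<in> W" for x y
  proof -
    have "x \<in> carrier (Gs (Suc n))" "y \<in> carrier (Gs (Suc n))"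
      using xy identity_neighbourhood_subset[OF W(1)] by blast+
    then show ?thesis using W(2)[OF xy] incl.inclusion_mult by simp
  qed
  ultimately have "product_set G V' (Suc n) \<subseteq> U"
    by (auto simp: V'_def set_mult_def)
  moreover have "\<forall>k\<le>Suc n. identity_neighbourhood (Gs k) (Ts k) (V' k)"
    using V(1) W(1) by (auto simp: V'_def le_Suc_eq)
  ultimately show ?case by blast
qed

text \<open>Index \<open>i\<close> refers to the group \<open>Gs (n + i)\<close>. Each
  \<open>A i\<close> is a halving of \<open>P i\<close>, and \<open>P (Suc i)\<close> extends
  \<open>A i\<close> to the next group without enlarging its trace.\<close>

lemma shrinking_neighbourhoods:
  assumes U: "identity_neighbourhood (Gs n) (Ts n) U"
  obtains P A where "P 0 = U"
    "\<And>i. identity_neighbourhood (Gs (n + i)) (Ts (n + i)) (P i)"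
    "\<And>i. identity_neighbourhood (Gs (n + i)) (Ts (n + i)) (A i)"
    "\<And>i x y. x \<in> A i \<Longrightarrow> y \<in> A i \<Longrightarrow> x \<otimes>\<^bsub>G\<^esub> y \<in> P i"
    "\<And>i. P (Suc i) \<inter> carrier (Gs (n + i)) \<subseteq> A i"
proof -
  let ?nb = "\<lambda>i. identity_neighbourhood (Gs (n + i)) (Ts (n + i))"
  \<comment> \<open>The properties of a single stage, as needed for dependent choice; the clause for
    \<open>i = 0\<close> fixes the starting value \<open>U\<close>.\<close>
  define good where "good i = (\<lambda>(P, A). (i = 0 \<longrightarrow> P = U) \<and> ?nb i P \<and> ?nb i A \<and>
    (\<forall>x\<in>A. \<forall>y\<in>A. x \<otimes>\<^bsub>G\<^esub> y \<in> P))" for i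
  have ex: "\<exists>A. ?nb i A \<and> (\<forall>x\<in>A. \<forall>y\<in>A. x \<otimes>\<^bsub>G\<^esub> y \<in> P)" if P: "?nb i P" for i P
  proof -
    obtain A where A: "?nb i A" "\<And>x y. x \<in> A \<Longrightarrow> y \<in> A \<Longrightarrow> x \<otimes>\<^bsub>Gs (n + i)\<^esub> y \<in> P"
      using incl.H.identity_neighbourhood_square[OF P] by blast
    have "x \<otimes>\<^bsub>G\<^esub> y \<in> P" if "x \<in> A" "y \<in> A" for x y
    proof -
      have "x \<in> carrier (Gs (n + i))" "y \<in> carrier (Gs (n + i))"
        using that identity_neighbourhood_subset[OF A(1)] by blast+
      then show ?thesis using A(2)[OF that] incl.inclusion_mult by simp
    qed
    then show ?thesis using A(1) by blast
  qed
  have "\<exists>f. \<forall>i. good i (f i) \<and> fst (f (Suc i)) \<inter> carrier (Gs (n + i)) \<subseteq> snd (f i)"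
  proof (rule dependent_nat_choice)
    show "\<exists>z. good 0 z" using U ex[of 0 U] by (auto simp: good_def)
    fix z i assume z: "good i z"
    interpret step: continuous_group_inclusion "Gs (n + i)" "Ts (n + i)"
      "Gs (Suc (n + i))" "Ts (Suc (n + i))"
      by (rule step_inclusion)
    have "?nb i (snd z)" using z by (auto simp: good_def)
    \<comment> \<open>Strictness enters here: along an embedding, \<open>A i\<close> contains the
      trace of a neighbourhood in the next group.\<close>
    then obtain P where P: "identity_neighbourhood (Gs (Suc (n + i))) (Ts (Suc (n + i))) P"
      "P \<inter> carrier (Gs (n + i)) \<subseteq> snd z"
      using step.embedding_extend_identity_neighbourhood[OF step_embedding] by blast
    then obtain A where "?nb (Suc i) A \<and> (\<forall>x\<in>A. \<forall>y\<in>A. x \<otimes>\<^bsub>G\<^esub> y \<in> P)"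
      using ex[of "Suc i" P] by auto
    then have "good (Suc i) (P, A)" using P by (auto simp: good_def)
    then show "\<exists>y. good (Suc i) y \<and> fst y \<inter> carrier (Gs (n + i)) \<subseteq> snd z"
      using P(2) by (intro exI[of _ "(P, A)"]) simp
  qed
  then obtain f where f: "\<And>i. good i (f i)"
    "\<And>i. fst (f (Suc i)) \<inter> carrier (Gs (n + i)) \<subseteq> snd (f i)"
    by blast
  have f': "(i = 0 \<longrightarrow> fst (f i) = U) \<and> ?nb i (fst (f i)) \<and> ?nb i (snd (f i)) \<and>
    (\<forall>x\<in>snd (f i). \<forall>y\<in>snd (f i). x \<otimes>\<^bsub>G\<^esub> y \<in> fst (f i))" for i
    using f(1)[of i] by (simp add: good_def split_beta)
  show ?thesis
    by (rule that[of "\<lambda>i. fst (f i)" "\<lambda>i. snd (f i)"]) (use f' f(2) in auto)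
qed

lemma product_set_trace_subset:
  assumes U: "identity_neighbourhood (Gs n) (Ts n) U"
  shows "\<exists>V. (\<forall>k. identity_neighbourhood (Gs k) (Ts k) (V k)) \<and>
    (\<Union>m. product_set G V m) \<inter> carrier (Gs n) \<subseteq> U"
proof -
  obtain P A where P0: "P 0 = U"
    and P: "\<And>i. identity_neighbourhood (Gs (n + i)) (Ts (n + i)) (P i)"
    and A: "\<And>i. identity_neighbourhood (Gs (n + i)) (Ts (n + i)) (A i)"
    and AP: "\<And>i x y. x \<in> A i \<Longrightarrow> y \<in> A i \<Longrightarrow> x \<otimes>\<^bsub>G\<^esub> y \<in> P i"
    and PA: "\<And>i. P (Suc i) \<inter> carrier (Gs (n + i)) \<subseteq> A i"
    using shrinking_neighbourhoods[OF U] by metis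
  obtain V0 where V0: "\<And>k. k \<le> n \<Longrightarrow> identity_neighbourhood (Gs k) (Ts k) (V0 k)"
    "product_set G V0 n \<subseteq> A 0"
    using product_set_subset_identity_neighbourhood[of n "A 0"] A[of 0] by auto
  \<comment> \<open>The factors up to index \<open>n\<close> multiply into \<open>A 0\<close>;
    beyond that, the factor at \<open>n + i\<close> is \<open>A i\<close>.\<close>
  define V where "V k = (if k \<le> n then V0 k else A (k - n))" for k
  have V: "identity_neighbourhood (Gs k) (Ts k) (V k)" for k
    using V0(1)[of k] A[of "k - n"] by (cases "k \<le> n") (simp_all add: V_def)
  have Vk: "V k \<subseteq> carrier (Gs k)" for k
    by (rule identity_neighbourhood_subset[OF V])
  have Vc: "V k \<subseteq> carrier G" for k
    using Vk[of k] incl.carrier_subset[of k] by (rule subset_trans)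
  have V1: "\<one>\<^bsub>G\<^esub> \<in> V k" for k
    using identity_neighbourhood_one[OF V[of k]] incl.inclusion_one[of k] by simp
  have Pc: "P i \<subseteq> carrier G" for i
    using identity_neighbourhood_subset[OF P] incl.carrier_subset by (rule subset_trans)
  have base: "product_set G V n \<subseteq> A 0"
    using V0(2) product_set_cong[of n V V0 G] by (simp add: V_def)
  \<comment> \<open>The extra factor \<open>p\<close> collects the factors already stripped from the
    right end, which is what makes the induction work.\<close>
  have collapse: "x \<otimes>\<^bsub>G\<^esub> p \<in> U"
    if "x \<in> product_set G V (n + i)" "p \<in> P (Suc i)" "x \<otimes>\<^bsub>G\<^esub> p \<in> carrier (Gs n)" for i x p
    using that
  proof (induction i arbitrary: x p)
    case 0
    then have x: "x \<in> A 0" using base by auto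
    then have "x \<in> carrier (Gs n)" using identity_neighbourhood_subset[OF A[of 0]] by auto
    then have "p \<in> carrier (Gs n)" using mult_mem_cancel_left 0 Pc by blast
    then have "p \<in> A 0" using PA[of 0] 0 by auto
    then show ?case using AP[OF x] P0 by simp
  next
    case (Suc i)
    \<comment> \<open>The last factor \<open>v\<close> of \<open>x\<close> lies in
      \<open>A (Suc i)\<close>. Once \<open>p\<close> is shown to lie in
      \<open>Gs (n + Suc i)\<close>, hence in \<open>A (Suc i)\<close>, both merge into
      \<open>v p\<close> in \<open>P (Suc i)\<close>, and \<open>y\<close> is shorter than
      \<open>x\<close>.\<close>
    obtain y v where yv: "y \<in> product_set G V (n + i)" "v \<in> A (Suc i)" "x = y \<otimes>\<^bsub>G\<^esub> v"
    proof -
      have "V (Suc (n + i)) = A (Suc i)" by (simp add: V_def)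
      then show ?thesis using Suc.prems(1) that by (auto simp: set_mult_def)
    qed
    have x: "x \<in> carrier (Gs (n + Suc i))"
      using product_set_subset_carrier[OF Vk] Suc.prems(1) by blast
    have "x \<otimes>\<^bsub>G\<^esub> p \<in> carrier (Gs (n + Suc i))"
      using Suc.prems(3) carrier_mono[of n "n + Suc i"] by auto
    then have "p \<in> carrier (Gs (n + Suc i))"
      using mult_mem_cancel_left x Suc.prems(2) Pc by blast
    then have "p \<in> A (Suc i)" using PA[of "Suc i"] Suc.prems(2) by auto
    then have vp: "v \<otimes>\<^bsub>G\<^esub> p \<in> P (Suc i)" using AP yv(2) by blast
    have "y \<in> carrier G"
      using G.product_set_closed[of V, OF Vc] yv(1) by blast
    moreover have "v \<in> carrier G" "p \<in> carrier G"
      using yv(2) Suc.prems(2) Pc identity_neighbourhood_subset[OF A[of "Suc i"]]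
        incl.carrier_subset[of "n + Suc i"] by blast+
    ultimately have "x \<otimes>\<^bsub>G\<^esub> p = y \<otimes>\<^bsub>G\<^esub> (v \<otimes>\<^bsub>G\<^esub> p)"
      using yv(3) by (simp add: G.m_assoc)
    then show ?case using Suc.IH[OF yv(1) vp] Suc.prems(3) by simp
  qed
  \<comment> \<open>Pad the product to length index \<open>n + m\<close> and start collapsing with
    \<open>p\<close> the identity.\<close>
  have "x \<in> U" if x: "x \<in> product_set G V m" "x \<in> carrier (Gs n)" for x m
  proof -
    have "x \<in> product_set G V (n + m)"
      using G.product_set_mono[of V m "n + m", OF Vc V1] x(1) by auto
    moreover have "\<one>\<^bsub>G\<^esub> \<in> P (Suc m)"
      using identity_neighbourhood_one[OF P[of "Suc m"]] incl.inclusion_one[of "n + Suc m"] by simp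
    moreover have "x \<otimes>\<^bsub>G\<^esub> \<one>\<^bsub>G\<^esub> = x" using x(2) incl.carrier_subset[of n] by auto
    ultimately show ?thesis using collapse[of x m "\<one>\<^bsub>G\<^esub>"] x(2) by simp
  qed
  then show ?thesis using V by (intro exI[of _ V]) auto
qed

lemma inclusion_embedding:
  assumes "product_sets_large Gs Ts G T"
  shows "embedding_map (Ts n) T (\<lambda>x. x)"
proof (rule incl.embedding_mapI)
  fix U assume "identity_neighbourhood (Gs n) (Ts n) U"
  then obtain V where "\<forall>k. identity_neighbourhood (Gs k) (Ts k) (V k)"
    "(\<Union>m. product_set G V m) \<inter> carrier (Gs n) \<subseteq> U"
    using product_set_trace_subset by blast
  then show "\<exists>W. identity_neighbourhood G T W \<and> W \<inter> carrier (Gs n) \<subseteq> U"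
    using assms unfolding product_sets_large_def by blast
qed

section \<open>Completeness of the limit\<close>

text \<open>The factors up to index \<open>n\<close> multiply into \<open>Gs n\<close>; all later
  ones are absorbed by \<open>U n\<close>, however many there are, because each
  \<open>U (Suc k)\<close> is a halving of \<open>U k\<close>.\<close>

lemma product_set_split:
  assumes Vk: "\<And>k. V k \<subseteq> carrier (Gs k)" and VU: "\<And>k. V k \<subseteq> U k"
    and Uc: "\<And>k. U k \<subseteq> carrier G" and U1: "\<And>k. \<one>\<^bsub>G\<^esub> \<in> U k"
    and UU: "\<And>k x y. x \<in> U (Suc k) \<Longrightarrow> y \<in> U (Suc k) \<Longrightarrow> x \<otimes>\<^bsub>G\<^esub> y \<in> U k"
    and w: "w \<in> product_set G V (n + i)"
  shows "\<exists>s\<in>carrier (Gs n). \<exists>t\<in>U n. w = s \<otimes>\<^bsub>G\<^esub> t"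
proof -
  \<comment> \<open>Strengthened for the induction: \<open>t\<close> maps all of
    \<open>U (n + i)\<close> into \<open>U n\<close>, which leaves room for the next factor. Taking
    \<open>u\<close> to be the identity recovers \<open>t \<in> U n\<close>.\<close>
  have "\<exists>s\<in>carrier (Gs n). \<exists>t\<in>carrier G. (\<forall>u\<in>U (n + i). t \<otimes>\<^bsub>G\<^esub> u \<in> U n) \<and> w = s \<otimes>\<^bsub>G\<^esub> t"
    using w
  proof (induction i arbitrary: w)
    case 0
    then have "w \<in> carrier (Gs n)"
      using product_set_subset_carrier[of n V, OF Vk] by auto
    then show ?case
      using incl.carrier_subset[of n] Uc[of n] by (intro bexI[of _ w] bexI[of _ "\<one>\<^bsub>G\<^esub>"]) auto
  next
    case (Suc i)
    obtain y v where yv: "y \<in> product_set G V (n + i)" "v \<in> V (Suc (n + i))" "w = y \<otimes>\<^bsub>G\<^esub> v"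
      using Suc.prems by (auto simp: set_mult_def)
    obtain s t where st: "s \<in> carrier (Gs n)" "t \<in> carrier G"
      "\<And>u. u \<in> U (n + i) \<Longrightarrow> t \<otimes>\<^bsub>G\<^esub> u \<in> U n" "y = s \<otimes>\<^bsub>G\<^esub> t"
      using Suc.IH[OF yv(1)] by blast
    have v: "v \<in> U (Suc (n + i))" "v \<in> carrier G" using yv(2) VU Uc by blast+
    have s: "s \<in> carrier G" using st(1) incl.carrier_subset by blast
    have "t \<otimes>\<^bsub>G\<^esub> v \<otimes>\<^bsub>G\<^esub> u \<in> U n" if u: "u \<in> U (Suc (n + i))" for u
    proof -
      have "u \<in> carrier G" using u Uc by blast
      then have "t \<otimes>\<^bsub>G\<^esub> v \<otimes>\<^bsub>G\<^esub> u = t \<otimes>\<^bsub>G\<^esub> (v \<otimes>\<^bsub>G\<^esub> u)"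
        using st(2) v(2) by (simp add: G.m_assoc)
      then show ?thesis using st(3)[OF UU[OF v(1) u]] by simp
    qed
    then show ?case
      using st v s yv(3) by (intro bexI[of _ s] bexI[of _ "t \<otimes>\<^bsub>G\<^esub> v"]) (auto simp: G.m_assoc)
  qed
  then obtain s t where st: "s \<in> carrier (Gs n)" "t \<in> carrier G" "t \<otimes>\<^bsub>G\<^esub> \<one>\<^bsub>G\<^esub> \<in> U n"
    "w = s \<otimes>\<^bsub>G\<^esub> t"
    using U1 by blast
  then show ?thesis by auto
qed

text \<open>A single \<open>n\<close> has to serve all \<open>c\<close> and \<open>U\<close>. If
  every \<open>n\<close> fails, the witnessing neighbourhoods are combined into one product set, to
  which the Cauchy property is applied.\<close>

lemma left_Cauchy_net_close_to_step:
  assumes large: "product_sets_large Gs Ts G T" and cauchy: "left_Cauchy_net G T A leq x"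
  obtains n where "\<And>c U. c \<in> A \<Longrightarrow> identity_neighbourhood G T U \<Longrightarrow>
    \<exists>a\<in>A. leq c a \<and> (\<exists>p\<in>carrier (Gs n). inv\<^bsub>G\<^esub> (x a) \<otimes>\<^bsub>G\<^esub> p \<in> U)"
proof (rule ccontr)
  let ?nb = "identity_neighbourhood G T"
  have dir: "directed_set A leq" and xG: "\<And>a. a \<in> A \<Longrightarrow> x a \<in> carrier G"
    using cauchy by (auto simp: left_Cauchy_net_def)
  assume "\<not> thesis"
  then have "\<forall>n. \<exists>c U. c \<in> A \<and> ?nb U \<and>
      (\<forall>a\<in>A. leq c a \<longrightarrow> (\<forall>p\<in>carrier (Gs n). inv\<^bsub>G\<^esub> (x a) \<otimes>\<^bsub>G\<^esub> p \<notin> U))"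
    using that by meson
  then obtain c B where c: "\<And>n. c n \<in> A" and B: "\<And>n. ?nb (B n)"
    and away: "\<And>n a p. a \<in> A \<Longrightarrow> leq (c n) a \<Longrightarrow> p \<in> carrier (Gs n) \<Longrightarrow>
      inv\<^bsub>G\<^esub> (x a) \<otimes>\<^bsub>G\<^esub> p \<notin> B n"
    by metis
  define good where "good n U \<longleftrightarrow> ?nb U \<and> U \<subseteq> B n \<and> (\<forall>u\<in>U. inv\<^bsub>G\<^esub> u \<in> U)" for n U
  have shrink: "\<exists>U. good n U \<and> (\<forall>u\<in>U. \<forall>v\<in>U. u \<otimes>\<^bsub>G\<^esub> v \<in> W)" if W: "?nb W" for n W
  proof -
    obtain U where U: "?nb U" "\<And>u v. u \<in> U \<Longrightarrow> v \<in> U \<Longrightarrow> u \<otimes>\<^bsub>G\<^esub> v \<in> W \<inter> B n"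
      "\<And>u. u \<in> U \<Longrightarrow> inv\<^bsub>G\<^esub> u \<in> U"
      using G.identity_neighbourhood_square[OF identity_neighbourhood_Int[OF W B[of n]]] by blast
    have "u \<in> B n" if "u \<in> U" for u
      using U(2)[OF that identity_neighbourhood_one[OF U(1)]] that
        identity_neighbourhood_subset[OF U(1)] by auto
    then show ?thesis using U by (auto simp: good_def)
  qed
  \<comment> \<open>Symmetric sets inside the witnesses \<open>B n\<close>, successively halved as
    \<open>product_set_split\<close> requires.\<close>
  have "\<exists>U. \<forall>n. good n (U n) \<and> (\<forall>u\<in>U (Suc n). \<forall>v\<in>U (Suc n). u \<otimes>\<^bsub>G\<^esub> v \<in> U n)"
  proof (rule dependent_nat_choice)
    show "\<exists>U. good 0 U" using shrink[OF G.identity_neighbourhood_carrier] by blast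
    show "\<exists>W. good (Suc n) W \<and> (\<forall>u\<in>W. \<forall>v\<in>W. u \<otimes>\<^bsub>G\<^esub> v \<in> U)" if "good n U" for U n
      using shrink that by (simp add: good_def)
  qed
  then obtain U where U: "\<And>n. good n (U n)"
    and UU: "\<And>n u v. u \<in> U (Suc n) \<Longrightarrow> v \<in> U (Suc n) \<Longrightarrow> u \<otimes>\<^bsub>G\<^esub> v \<in> U n"
    by blast
  have Unb: "?nb (U n)" for n using U by (simp add: good_def)
  define V where "V n = U n \<inter> carrier (Gs n)" for n
  have V: "identity_neighbourhood (Gs n) (Ts n) (V n)" for n
    unfolding V_def by (rule incl.identity_neighbourhood_trace[OF Unb])
  have Vc: "V k \<subseteq> carrier G" for k
    using identity_neighbourhood_subset[OF Unb] by (auto simp: V_def)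
  have V1: "\<one>\<^bsub>G\<^esub> \<in> V k" for k
    using identity_neighbourhood_one[OF V[of k]] incl.inclusion_one[of k] by simp
  have "?nb (\<Union>n. product_set G V n)"
    using large V unfolding product_sets_large_def by blast
  then have "\<exists>d\<in>A. \<forall>a\<in>A. \<forall>b\<in>A. leq d a \<longrightarrow> leq d b \<longrightarrow>
      inv\<^bsub>G\<^esub> (x b) \<otimes>\<^bsub>G\<^esub> x a \<in> (\<Union>n. product_set G V n)"
    using cauchy by (simp only: left_Cauchy_net_def)
  then obtain d where d: "d \<in> A"
    "\<And>a b. a \<in> A \<Longrightarrow> b \<in> A \<Longrightarrow> leq d a \<Longrightarrow> leq d b \<Longrightarrow>
      inv\<^bsub>G\<^esub> (x b) \<otimes>\<^bsub>G\<^esub> x a \<in> (\<Union>n. product_set G V n)"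
    by metis
  \<comment> \<open>The stage \<open>n\<close> is chosen only after \<open>d\<close>, so that
    \<open>x d\<close> lies in \<open>Gs n\<close>. This is possible because the product set takes
    care of all stages at once.\<close>
  obtain n where n: "x d \<in> carrier (Gs n)" using xG[OF d(1)] carrier_limit by blast
  obtain a where a: "a \<in> A" "leq d a" "leq (c n) a"
    using dir d(1) c[of n] unfolding directed_set_def by blast
  have "leq d d" using dir d(1) by (simp add: directed_set_def)
  then obtain m where "inv\<^bsub>G\<^esub> (x d) \<otimes>\<^bsub>G\<^esub> x a \<in> product_set G V m"
    using d(2)[OF a(1) d(1) a(2)] by blast
  then have "inv\<^bsub>G\<^esub> (x d) \<otimes>\<^bsub>G\<^esub> x a \<in> product_set G V (n + m)"
    using G.product_set_mono[of V m "n + m", OF Vc V1] by auto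
  then have "\<exists>s\<in>carrier (Gs n). \<exists>t\<in>U n. inv\<^bsub>G\<^esub> (x d) \<otimes>\<^bsub>G\<^esub> x a = s \<otimes>\<^bsub>G\<^esub> t"
    using UU by (intro product_set_split[where V = V])
      (auto simp: V_def identity_neighbourhood_one[OF Unb]
        dest: identity_neighbourhood_subset[OF Unb, THEN subsetD])
  then obtain s t where st: "s \<in> carrier (Gs n)" "t \<in> U n"
    "inv\<^bsub>G\<^esub> (x d) \<otimes>\<^bsub>G\<^esub> x a = s \<otimes>\<^bsub>G\<^esub> t"
    by blast
  have mem: "s \<in> carrier G" "t \<in> carrier G" "x a \<in> carrier G" "x d \<in> carrier G"
    using st identity_neighbourhood_subset[OF Unb] incl.carrier_subset xG a d by blast+
  have "x a = x d \<otimes>\<^bsub>G\<^esub> (inv\<^bsub>G\<^esub> (x d) \<otimes>\<^bsub>G\<^esub> x a)"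
    using mem by (simp add: G.m_assoc[symmetric])
  then have "x a = x d \<otimes>\<^bsub>G\<^esub> s \<otimes>\<^bsub>G\<^esub> t" using mem st(3) by (simp add: G.m_assoc)
  \<comment> \<open>The point \<open>x d s\<close> of \<open>Gs n\<close> differs from
    \<open>x a\<close> only by \<open>t\<close> in \<open>U n\<close>. By symmetry
    \<open>t^-1\<close> lies in \<open>B n\<close>, against the choice of \<open>c n\<close> and
    \<open>B n\<close>.\<close>
  then have "inv\<^bsub>G\<^esub> (x a) \<otimes>\<^bsub>G\<^esub> (x d \<otimes>\<^bsub>G\<^esub> s) = inv\<^bsub>G\<^esub> t"
  proof -
    have "inv\<^bsub>G\<^esub> (q \<otimes>\<^bsub>G\<^esub> t) \<otimes>\<^bsub>G\<^esub> q = inv\<^bsub>G\<^esub> t" if "q \<in> carrier G" for q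
      using that mem by (simp add: G.inv_mult_group G.m_assoc)
    from this[of "x d \<otimes>\<^bsub>G\<^esub> s"] show ?thesis
      using \<open>x a = x d \<otimes>\<^bsub>G\<^esub> s \<otimes>\<^bsub>G\<^esub> t\<close> mem by simp
  qed
  moreover have "inv\<^bsub>G\<^esub> t \<in> B n" using U[of n] st(2) by (auto simp: good_def)
  ultimately show False
    using away[OF a(1,3) mult_closed[OF n st(1)]] by simp
qed

lemma complete_limit:
  assumes "product_sets_large Gs Ts G T" "\<And>n. complete_group (Gs n) (Ts n)"
  shows "complete_group G T"
  unfolding complete_group_def
proof (intro allI impI)
  fix A :: "('a set \<times> 'a) set" and leq x
  assume cauchy: "left_Cauchy_net G T A leq x"
  obtain n where "\<And>c U. c \<in> A \<Longrightarrow> identity_neighbourhood G T U \<Longrightarrow>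
    \<exists>a\<in>A. leq c a \<and> (\<exists>p\<in>carrier (Gs n). inv\<^bsub>G\<^esub> (x a) \<otimes>\<^bsub>G\<^esub> p \<in> U)"
    using left_Cauchy_net_close_to_step[OF assms(1) cauchy] by blast
  then show "\<exists>g. net_converges T A leq x g"
    by (rule incl.left_Cauchy_net_converges_if_close_to_complete_subgroup[OF
          inclusion_embedding[OF assms(1)] assms(2) cauchy])
qed

end

theorem theoremA:
  fixes Gs :: "nat \<Rightarrow> ('a, 'b) monoid_scheme" and Ts :: "nat \<Rightarrow> 'a topology"
    and G :: "('a, 'c) monoid_scheme" and T :: "'a topology"
  assumes "strict_direct_sequence Gs Ts"
    and "direct_limit_topological_group Gs Ts G T"
  shows "(product_sets_large Gs Ts G T \<longrightarrow>
            (\<forall>n. embedding_map (Ts n) T (\<lambda>x. x))) \<and>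
         (product_sets_large Gs Ts G T \<and> (\<forall>n. complete_group (Gs n) (Ts n)) \<longrightarrow>
            complete_group G T)"
proof -
  interpret strict_direct_limit Gs Ts G T
    using assms by unfold_locales
  show ?thesis using inclusion_embedding complete_limit by blast
qed

end
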